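(* Let $(M,\mathcal T)$ be a closed triangulated surface with inversive distance $I\ge0$ in hyperbolic background geometry. If there exists a zero curvature metric (i.e. $r\in\Omega$ with $K_i(r)=0$ for all $i\in V$), then for each nonempty proper subset $A\subset V$, $$\sum_{(e,v)\in Lk(A)}\big(\pi-\Lambda(I_e)\big)>2\pi\chi(F_A).$$
   Context: Setting. $M$ is a closed surface with a triangulation $\mathcal T=\{V,E,F\}$ (vertices, edges, faces), with vertices numbered $1,\dots,N$. The inversive distance is a fixed function $I:E\to[0,+\infty)$, with value $I_e$ or $I_{ij}$ on the edge $e=\{ij\}$. For $r=(r_1,\dots,r_N)\in\mathbb R^N_{>0}$, each edge $\{ij\}$ gets the hyperbolic length $l_{ij}=\cosh^{-1}(\cosh r_i\cosh r_j+I_{ij}\sinh r_i\sinh r_j)$. $\Omega$ is the set of $r\in\mathbb R^N_{>0}$ such that for every face $\{ijk\}\in F$ the lengths $l_{ij},l_{jk},l_{ik}$ satisfy the three strict triangle inequalities. For $r\in\Omega$, $\theta_i^{jk}$ is the inner angle at vertex $i$ of the hyperbolic triangle with edge lengths $l_{ij},l_{jk},l_{ik}$, and $K_i(r)=2\pi-\sum_{\{ijk\}\in F}\theta_i^{jk}$ (sum over faces containing $i$). Notation. $F_A$ is the subcomplex of $\mathcal T$ consisting of all simplices whose vertices all lie in $A$, and $\chi(F_A)$ is its Euler characteristic. $Lk(A)$ is the set of pairs $(e,v)$ of an edge $e$ and a vertex $v$ such that the end points of $e$ are not in $A$, $v\in A$, and $e$ and $v$ form a triangle of $F$. The function $\Lambda:\mathbb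 R\to[0,\pi]$ is $\Lambda(x)=\pi$ for $x\le-1$, $\Lambda(x)=\arccos x$ for $-1\le x\le1$, $\Lambda(x)=0$ for $x\ge1$. *)

theory Defs
  imports "HOL-Analysis.Analysis"
begin

definition closed_surface :: "'a topology \<Rightarrow> bool" where
  "closed_surface M \<longleftrightarrow>
     topspace M \<noteq> {} \<and> compact_space M \<and> connected_space M \<and> Hausdorff_space M \<and>
     (\<forall>p\<in>topspace M. \<exists>U (W :: (real^2) set).
        openin M U \<and> p \<in> U \<and> open W \<and> subtopology M U homeomorphic_space top_of_set W)"

(* The vertices 1, ..., N are the elements of a finite type 'v, so that every element of 'v is a
   vertex; a simplex is identified with its set of vertices. *)

definition simplices :: "'v set set \<Rightarrow> 'v set set \<Rightarrow> 'v set set" where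
  "simplices E F = range (\<lambda>i. {i}) \<union> E \<union> F"

definition realization :: "'v::finite set set \<Rightarrow> 'v set set \<Rightarrow> (real^'v) set" where
  "realization E F = (\<Union>s\<in>simplices E F. convex hull ((\<lambda>i. axis i 1) ` s))"

definition triangulates :: "'a topology \<Rightarrow> 'v::finite set set \<Rightarrow> 'v set set \<Rightarrow> bool" where
  "triangulates M E F \<longleftrightarrow>
     (\<forall>e\<in>E. card e = 2) \<and> (\<forall>f\<in>F. card f = 3) \<and>
     (\<forall>f\<in>F. \<forall>e. e \<subseteq> f \<and> card e = 2 \<longrightarrow> e \<in> E) \<and>
     M homeomorphic_space top_of_set (realization E F)"

definition full_subcomplex :: "'v set set \<Rightarrow> 'v set set \<Rightarrow> 'v set \<Rightarrow> 'v set set" where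
  "full_subcomplex E F A = {s \<in> simplices E F. s \<subseteq> A}"

definition euler_characteristic :: "'v set set \<Rightarrow> int" where
  "euler_characteristic K = (\<Sum>s\<in>K. (-1) ^ (card s - 1))"

definition Lk :: "'v set set \<Rightarrow> 'v set set \<Rightarrow> 'v set \<Rightarrow> ('v set \<times> 'v) set" where
  "Lk E F A = {(e, v). e \<in> E \<and> e \<inter> A = {} \<and> v \<in> A \<and> insert v e \<in> F}"

definition Lam :: "real \<Rightarrow> real" where
  "Lam x = (if x \<le> -1 then pi else if x \<ge> 1 then 0 else arccos x)"

(* Hyperbolic angles are taken in the hyperboloid model of the hyperbolic plane. *)

definition mink :: "real^3 \<Rightarrow> real^3 \<Rightarrow> real" where
  "mink x y = x$1 * y$1 + x$2 * y$2 - x$3 * y$3"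

definition hyp_plane :: "(real^3) set" where
  "hyp_plane = {x. mink x x = -1 \<and> x$3 > 0}"

definition hyp_dist :: "real^3 \<Rightarrow> real^3 \<Rightarrow> real" where
  "hyp_dist x y = arcosh (- mink x y)"

(* The component of q tangent to the hyperboloid at p: for q \<noteq> p, a positive multiple of the
   initial velocity of the geodesic from p to q. *)
definition hyp_dir :: "real^3 \<Rightarrow> real^3 \<Rightarrow> real^3" where
  "hyp_dir p q = q + mink p q *\<^sub>R p"

definition hyp_angle :: "real^3 \<Rightarrow> real^3 \<Rightarrow> real^3 \<Rightarrow> real" where
  "hyp_angle p q s =
     (let u = hyp_dir p q; w = hyp_dir p s
      in arccos (mink u w / (sqrt (mink u u) * sqrt (mink w w))))"

(* The inner angle, between the sides of lengths a and b, of a hyperbolic triangle with side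
   lengths a, b, c.  By inner_angle_eq below the description is well defined whenever a, b, c are
   positive and satisfy the strict triangle inequalities. *)
definition inner_angle :: "real \<Rightarrow> real \<Rightarrow> real \<Rightarrow> real" where
  "inner_angle a b c =
     (THE \<alpha>. \<exists>p\<in>hyp_plane. \<exists>q\<in>hyp_plane. \<exists>s\<in>hyp_plane.
        hyp_dist p q = a \<and> hyp_dist p s = b \<and> hyp_dist q s = c \<and> \<alpha> = hyp_angle p q s)"

lemma hyp_angle_cosine_law:
  assumes "p \<in> hyp_plane" "q \<in> hyp_plane" "s \<in> hyp_plane"
    and "hyp_dist p q = a" "hyp_dist p s = b" "hyp_dist q s = c"
  shows "hyp_angle p q s = arccos ((cosh a * cosh b - cosh c) / (sinh a * sinh b))"
proof -
  have ge1: "- mink x y \<ge> 1" if "x \<in> hyp_plane" "y \<in> hyp_plane" for x y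
  proof -
    have x: "(x$3)\<^sup>2 = 1 + (x$1)\<^sup>2 + (x$2)\<^sup>2" "x$3 > 0"
      and y: "(y$3)\<^sup>2 = 1 + (y$1)\<^sup>2 + (y$2)\<^sup>2" "y$3 > 0"
      using that by (auto simp: hyp_plane_def mink_def power2_eq_square)
    have "(x$3 * y$3)\<^sup>2 - (1 + x$1 * y$1 + x$2 * y$2)\<^sup>2 =
        (x$1 - y$1)\<^sup>2 + (x$2 - y$2)\<^sup>2 + (x$1 * y$2 - x$2 * y$1)\<^sup>2"
      unfolding power_mult_distrib x(1) y(1) by (simp add: power2_eq_square algebra_simps)
    hence "(1 + x$1 * y$1 + x$2 * y$2)\<^sup>2 \<le> (x$3 * y$3)\<^sup>2"
      by (smt (verit) zero_le_power2)
    hence "1 + x$1 * y$1 + x$2 * y$2 \<le> x$3 * y$3"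
      by (rule power2_le_imp_le) (use x(2) y(2) in simp)
    thus ?thesis by (simp add: mink_def)
  qed
  have cosh_dist: "cosh (hyp_dist x y) = - mink x y" "hyp_dist x y \<ge> 0"
    if "x \<in> hyp_plane" "y \<in> hyp_plane" for x y
    using ge1[OF that] by (auto simp: hyp_dist_def)
  have bilin: "mink (hyp_dir p x) (hyp_dir p y) = mink x y + mink p x * mink p y"
    if "p \<in> hyp_plane" for x y
  proof -
    have "mink (hyp_dir p x) (hyp_dir p y) =
        mink x y + 2 * mink p x * mink p y + mink p x * mink p y * mink p p"
      by (simp add: mink_def hyp_dir_def algebra_simps)
    thus ?thesis using that by (simp add: hyp_plane_def)
  qed
  have sqrt_dir: "sqrt (mink (hyp_dir p x) (hyp_dir p x)) = sinh (hyp_dist p x)"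
    if "x \<in> hyp_plane" for x
  proof -
    have "mink (hyp_dir p x) (hyp_dir p x) = (cosh (hyp_dist p x))\<^sup>2 - 1"
      using that assms(1) bilin[of x x] by (simp add: cosh_dist hyp_plane_def power2_eq_square)
    thus ?thesis using cosh_dist(2)[OF assms(1) that] by (simp add: cosh_square_eq)
  qed
  have "mink p q = - cosh a" "mink p s = - cosh b" "mink q s = - cosh c"
    using assms cosh_dist(1)[of p q] cosh_dist(1)[of p s] cosh_dist(1)[of q s] by auto
  thus ?thesis
    using assms bilin[of q s] by (simp add: hyp_angle_def sqrt_dir)
qed

lemma inner_angle_eq:
  assumes "a > 0" "b > 0" "c > 0" "a < b + c" "b < a + c" "c < a + b"
  shows "inner_angle a b c = arccos ((cosh a * cosh b - cosh c) / (sinh a * sinh b))"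
proof -
  define k where "k = (cosh a * cosh b - cosh c) / (sinh a * sinh b)"
  define \<alpha> where "\<alpha> = arccos k"
  have pos: "sinh a * sinh b > 0" using assms by simp
  have "cosh c < cosh (a + b)" using assms by (subst cosh_real_nonneg_less_iff) auto
  moreover have "cosh (a - b) < cosh c"
  proof -
    have "cosh \<bar>a - b\<bar> < cosh c" using assms by (subst cosh_real_nonneg_less_iff) auto
    thus ?thesis by (simp add: abs_if) (smt (verit) cosh_minus)
  qed
  ultimately have "\<bar>k\<bar> \<le> 1"
    using pos by (auto simp: k_def cosh_add cosh_diff abs_le_iff divide_simps)
  hence cos: "cos \<alpha> = k" by (simp add: \<alpha>_def)
  have k: "sinh a * sinh b * k = cosh a * cosh b - cosh c"
    using assms by (simp add: k_def)
  define p q s :: "real^3" where "p = vector [0, 0, 1]" and "q = vector [sinh a, 0, cosh a]"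
    and "s = vector [sinh b * cos \<alpha>, sinh b * sin \<alpha>, cosh b]"
  have "(sinh b * cos \<alpha>)\<^sup>2 + (sinh b * sin \<alpha>)\<^sup>2 = (sinh b)\<^sup>2"
    by (simp add: power_mult_distrib flip: distrib_left)
  hence "p \<in> hyp_plane" "q \<in> hyp_plane" "s \<in> hyp_plane"
    by (simp_all add: p_def q_def s_def hyp_plane_def mink_def flip: power2_eq_square)
       (simp_all add: cosh_square_eq)
  moreover have "hyp_dist p q = a" "hyp_dist p s = b" "hyp_dist q s = c"
    using assms k by (simp_all add: p_def q_def s_def hyp_dist_def mink_def cos arcosh_cosh_real
        mult.assoc[symmetric])
  ultimately show ?thesis
    unfolding inner_angle_def using hyp_angle_cosine_law
    by (intro the_equality) (metis, blast)
qed

definition edge_length :: "('v set \<Rightarrow> real) \<Rightarrow> real^'v \<Rightarrow> 'v \<Rightarrow> 'v \<Rightarrow> real" where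
  "edge_length I r i j =
     arcosh (cosh (r$i) * cosh (r$j) + I {i, j} * sinh (r$i) * sinh (r$j))"

(* As F consists of 3-element sets and is tested on all orderings, the single inequality
   stands for all three. *)
definition Omega :: "('v set \<Rightarrow> real) \<Rightarrow> 'v set set \<Rightarrow> (real^'v) set" where
  "Omega I F =
     {r. (\<forall>i. r$i > 0) \<and>
         (\<forall>i j k. {i, j, k} \<in> F \<longrightarrow>
            edge_length I r i j < edge_length I r i k + edge_length I r j k)}"

(* The angle at i in the face f; inner_angle is symmetric in its first two arguments, so the
   value does not depend on the order of j and k. *)
definition face_angle :: "('v set \<Rightarrow> real) \<Rightarrow> real^'v \<Rightarrow> 'v \<Rightarrow> 'v set \<Rightarrow> real" where
  "face_angle I r i f =
     (THE \<alpha>. \<exists>j k. f = {i, j, k} \<and>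
        \<alpha> = inner_angle (edge_length I r i j) (edge_length I r i k) (edge_length I r j k))"

definition curvature :: "('v set \<Rightarrow> real) \<Rightarrow> 'v set set \<Rightarrow> real^'v \<Rightarrow> 'v \<Rightarrow> real" where
  "curvature I F r i = 2 * pi - (\<Sum>f\<in>{f \<in> F. i \<in> f}. face_angle I r i f)"

end

theory Submission
  imports Defs
begin

text \<open>
  Adding up the vanishing curvatures at the vertices of \<open>A\<close> shows that all the face angles at
  vertices of \<open>A\<close> together make up \<open>2 * pi * card A\<close>.  The same angles can be bounded face by face.
  A face with at least two vertices in \<open>A\<close> contributes less than \<open>pi\<close>, a strict bound for the angle
  sum of a hyperbolic triangle (\<open>hyperbolic_angle_sum_less_pi\<close>).  A face with a single vertex \<open>v\<close> in \<open>A\<close> corresponds to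
  the pair \<open>(e, v)\<close> of the link, where \<open>e\<close> is its opposite edge, and contributes less than
  \<open>pi - Lam (I e)\<close> (\<open>face_angle_less_Lam\<close>): the side \<open>e\<close> joins the centres of two circles of inversive
  distance \<open>I e\<close>, and as the other two inversive distances are nonnegative, the sides from \<open>v\<close> are
  longer than the radii of these circles.  Hence \<open>2 * pi * card A\<close> is less than the sum over the link
  plus \<open>pi\<close> times the number of faces with at least two vertices in \<open>A\<close>.

  It remains to compare this number with the Euler characteristic.  In a surface an edge lies in at
  most two triangles (\<open>edge_in_at_most_two_faces\<close>): two triangles glued along an edge already contain
  an open disc around its midpoint, which by invariance of domain is open in the surface and so
  leaves no room for a third triangle.  Counting incidences of edges and faces inside \<open>A\<close>, three for
  each face within \<open>A\<close> and one for each face with exactly two vertices in \<open>A\<close>, then gives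
  \<open>euler_characteristic_double_count\<close>.  The inequality stays strict because some face meets \<open>A\<close>:
  a vertex in no face would have curvature \<open>2 * pi\<close>.
\<close>

section \<open>Angles of hyperbolic triangles\<close>

definition cosine_ratio :: "real \<Rightarrow> real \<Rightarrow> real \<Rightarrow> real" where
  "cosine_ratio a b c = (cosh a * cosh b - cosh c) / (sinh a * sinh b)"

definition hyp_sides :: "real \<Rightarrow> real \<Rightarrow> real \<Rightarrow> bool" where
  "hyp_sides a b c \<longleftrightarrow> a > 0 \<and> b > 0 \<and> c > 0 \<and> a < b + c \<and> b < a + c \<and> c < a + b"

lemma hyp_sides_rotate: "hyp_sides a b c \<Longrightarrow> hyp_sides b c a"
  by (auto simp: hyp_sides_def)

lemma inner_angle_arccos:
  "hyp_sides a b c \<Longrightarrow> inner_angle a b c = arccos (cosine_ratio a b c)"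
  unfolding hyp_sides_def cosine_ratio_def by (intro inner_angle_eq) auto

lemma inner_angle_commute:
  assumes "hyp_sides a b c"
  shows "inner_angle b a c = inner_angle a b c"
proof -
  have "hyp_sides b a c" using assms by (auto simp: hyp_sides_def)
  then show ?thesis
    using assms by (simp add: inner_angle_arccos cosine_ratio_def mult.commute)
qed

lemma cosine_ratio_bounds:
  assumes "hyp_sides a b c"
  shows "-1 < cosine_ratio a b c" and "cosine_ratio a b c < 1"
proof -
  have pos: "a > 0" "b > 0" "c > 0" and tri: "a < b + c" "b < a + c" "c < a + b"
    using assms by (auto simp: hyp_sides_def)
  have den: "sinh a * sinh b > 0" using pos by simp
  have "cosh c < cosh (a + b)" using pos tri by (subst cosh_real_nonneg_less_iff) auto
  then show "-1 < cosine_ratio a b c"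
    using den by (simp add: cosine_ratio_def cosh_add field_simps)
  have "cosh \<bar>a - b\<bar> < cosh c" using pos tri by (subst cosh_real_nonneg_less_iff) auto
  then have "cosh (a - b) < cosh c" by (simp add: abs_if split: if_splits) (metis cosh_minus minus_diff_eq)
  then show "cosine_ratio a b c < 1"
    using den by (simp add: cosine_ratio_def cosh_diff field_simps)
qed

lemma inner_angle_range:
  assumes "hyp_sides a b c"
  shows "0 < inner_angle a b c" and "inner_angle a b c < pi"
  using cosine_ratio_bounds[OF assms] arccos_lt_bounded[of "cosine_ratio a b c"]
  by (simp_all add: inner_angle_arccos assms)

lemma cos_inner_angle: "hyp_sides a b c \<Longrightarrow> cos (inner_angle a b c) = cosine_ratio a b c"
  using cosine_ratio_bounds by (simp add: inner_angle_arccos less_imp_le)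

text \<open>
  This is the determinant of the matrix of the numbers \<open>- mink x y\<close>, for \<open>x\<close> and \<open>y\<close> among the
  three vertices.
\<close>

definition gram :: "real \<Rightarrow> real \<Rightarrow> real \<Rightarrow> real" where
  "gram a b c = 1 + 2 * cosh a * cosh b * cosh c - (cosh a)\<^sup>2 - (cosh b)\<^sup>2 - (cosh c)\<^sup>2"

text \<open>
  Since \<open>gram\<close> is symmetric in the three sides, the formula for the sine contains the hyperbolic law of
  sines.
\<close>

lemma sin_inner_angle:
  assumes "hyp_sides a b c"
  shows "gram a b c \<ge> 0"
    and "sin (inner_angle a b c) = sqrt (gram a b c) / (sinh a * sinh b)"
proof -
  have den: "sinh a * sinh b > 0" using assms by (simp add: hyp_sides_def)
  have ne: "sinh a \<noteq> 0" "sinh b \<noteq> 0" using den by auto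
  have "(sinh a * sinh b)\<^sup>2 = ((cosh a)\<^sup>2 - 1) * ((cosh b)\<^sup>2 - 1)"
    by (simp add: power_mult_distrib sinh_square_eq)
  then have gram: "gram a b c = (sinh a * sinh b)\<^sup>2 - (cosh a * cosh b - cosh c)\<^sup>2"
    by (simp add: gram_def power2_eq_square algebra_simps)
  have sq: "1 - (cosine_ratio a b c)\<^sup>2 = gram a b c / (sinh a * sinh b)\<^sup>2"
    unfolding gram cosine_ratio_def using ne
    by (simp only: power_divide diff_divide_distrib[of _ _ "(sinh a * sinh b)\<^sup>2"]) simp
  have "\<bar>cosine_ratio a b c\<bar> \<le> 1" using cosine_ratio_bounds[OF assms] by simp
  then have "0 \<le> 1 - (cosine_ratio a b c)\<^sup>2" by (simp add: abs_square_le_1)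
  then show "gram a b c \<ge> 0"
    unfolding sq using ne by (auto simp: zero_le_divide_iff)
  show "sin (inner_angle a b c) = sqrt (gram a b c) / (sinh a * sinh b)"
    using cosine_ratio_bounds[OF assms] den
    by (simp add: inner_angle_arccos[OF assms] sin_arccos sq real_sqrt_divide)
qed

text \<open>
  This is the dual law of cosines, \<open>cos \<gamma> = - cos \<alpha> * cos \<beta> + sin \<alpha> * sin \<beta> * cosh c\<close>.  After the law of
  sines has removed the square roots it is a polynomial identity in the hyperbolic cosines.
\<close>

lemma dual_cosine_law:
  assumes "hyp_sides a b c"
  shows "cos (inner_angle a b c) = - cos (inner_angle b c a) * cos (inner_angle c a b)
           + sin (inner_angle b c a) * sin (inner_angle c a b) * cosh c"
proof -
  have s1: "hyp_sides b c a" and s2: "hyp_sides c a b"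
    using assms hyp_sides_rotate by blast+
  have ne: "sinh a \<noteq> 0" "sinh b \<noteq> 0" "sinh c \<noteq> 0" using assms by (auto simp: hyp_sides_def)
  have g: "gram b c a = gram a b c" "gram c a b = gram a b c"
    by (simp_all add: gram_def)
  have "sin (inner_angle b c a) * sin (inner_angle c a b)
      = gram a b c / (sinh a * sinh b * (sinh c)\<^sup>2)"
    using sin_inner_angle(1)[OF assms]
    by (simp add: sin_inner_angle(2)[OF s1] sin_inner_angle(2)[OF s2] g power2_eq_square)
  moreover have "cosine_ratio a b c + cosine_ratio b c a * cosine_ratio c a b
      = ((cosh a * cosh b - cosh c) * (sinh c)\<^sup>2
          + (cosh b * cosh c - cosh a) * (cosh c * cosh a - cosh b))
        / (sinh a * sinh b * (sinh c)\<^sup>2)"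
    using ne by (simp add: cosine_ratio_def divide_simps) (simp add: power2_eq_square algebra_simps)
  moreover have "(cosh a * cosh b - cosh c) * (sinh c)\<^sup>2
          + (cosh b * cosh c - cosh a) * (cosh c * cosh a - cosh b) = gram a b c * cosh c"
    unfolding sinh_square_eq gram_def by (simp add: power2_eq_square algebra_simps)
  ultimately show ?thesis
    by (simp add: cos_inner_angle assms s1 s2)
qed

text \<open>
  Replacing \<open>cosh c\<close> by \<open>1\<close> in the dual law of cosines gives \<open>cos \<gamma> > cos (pi - (\<alpha> + \<beta>))\<close>.  The second
  alternative is what this means when \<open>\<alpha> + \<beta> \<ge> pi\<close>.
\<close>

lemma angle_sum_alternative:
  assumes "hyp_sides a b c"
  shows "inner_angle a b c + inner_angle b c a + inner_angle c a b < pi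
       \<or> inner_angle a b c + pi < inner_angle b c a + inner_angle c a b"
proof -
  let ?x = "inner_angle b c a" and ?y = "inner_angle c a b" and ?z = "inner_angle a b c"
  have s1: "hyp_sides b c a" and s2: "hyp_sides c a b"
    using assms hyp_sides_rotate by blast+
  note range = inner_angle_range[OF assms] inner_angle_range[OF s1] inner_angle_range[OF s2]
  have "cosh c > cosh 0" using assms by (subst cosh_real_nonneg_less_iff) (auto simp: hyp_sides_def)
  then have "sin ?x * sin ?y < sin ?x * sin ?y * cosh c"
    using range by (simp add: sin_gt_zero)
  then have "cos ?z > - cos (?x + ?y)"
    using dual_cosine_law[OF assms] by (simp add: cos_add)
  then have gt: "cos ?z > cos \<bar>pi - (?x + ?y)\<bar>"
    by (simp add: abs_if cos_diff)
  have "?z < \<bar>pi - (?x + ?y)\<bar>"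
    using gt range by (subst cos_mono_less_eq[symmetric]) auto
  then show ?thesis by (auto simp: abs_if split: if_splits)
qed

text \<open>
  If the first alternative failed, the second would hold for each of the three angles, and the sum of
  two of these inequalities says that an angle exceeds \<open>pi\<close>.
\<close>

theorem hyperbolic_angle_sum_less_pi:
  assumes "hyp_sides a b c"
  shows "inner_angle a b c + inner_angle b c a + inner_angle c a b < pi"
proof -
  have s1: "hyp_sides b c a" and s2: "hyp_sides c a b"
    using assms hyp_sides_rotate by blast+
  show ?thesis
    using angle_sum_alternative[OF assms] angle_sum_alternative[OF s1]
      inner_angle_range(2)[OF s2] by linarith
qed

section \<open>Angles of circle patterns\<close>

lemma edge_length_commute: "edge_length I r i j = edge_length I r j i"
  by (simp add: edge_length_def insert_commute mult_ac)

lemma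
  assumes "r$i > 0" "r$j > 0" "I {i, j} \<ge> 0"
  shows edge_length_nonneg: "0 \<le> edge_length I r i j"
    and cosh_edge_length:
      "cosh (edge_length I r i j) = cosh (r$i) * cosh (r$j) + I {i, j} * sinh (r$i) * sinh (r$j)"
proof -
  have "1 \<le> cosh (r$i) * cosh (r$j)"
    using mult_mono[of 1 "cosh (r$i)" 1 "cosh (r$j)"] by (simp add: cosh_real_ge_1)
  moreover have "0 \<le> I {i, j} * sinh (r$i) * sinh (r$j)" using assms by simp
  ultimately have "1 \<le> cosh (r$i) * cosh (r$j) + I {i, j} * sinh (r$i) * sinh (r$j)" by linarith
  then show "0 \<le> edge_length I r i j"
    and "cosh (edge_length I r i j) = cosh (r$i) * cosh (r$j) + I {i, j} * sinh (r$i) * sinh (r$j)"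
    by (simp_all add: edge_length_def)
qed

text \<open>
  The triangle formed by two perpendicular sides equal to the radii has a hypotenuse longer than
  either of them, and a positive inversive distance lengthens the edge beyond this hypotenuse.
\<close>

lemma radius_less_edge_length:
  assumes "r$i > 0" "r$j > 0" "I {i, j} \<ge> 0"
  shows "r$j < edge_length I r i j"
proof -
  have "cosh (r$i) > cosh 0" using assms by (subst cosh_real_nonneg_less_iff) auto
  then have "1 * cosh (r$j) < cosh (r$i) * cosh (r$j)"
    by (intro mult_strict_right_mono) (auto simp: cosh_real_pos)
  moreover have "0 \<le> I {i, j} * sinh (r$i) * sinh (r$j)" using assms by simp
  ultimately have "cosh (r$j) < cosh (edge_length I r i j)"
    unfolding cosh_edge_length[of r i j I, OF assms] by linarith
  then show ?thesis
    using edge_length_nonneg[of r i j I] assms by (subst cosh_real_nonneg_less_iff[symmetric]) auto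
qed

text \<open>
  Both sides at \<open>i\<close> are longer than the radii at their other ends \<open>j\<close> and \<open>k\<close>, and the expression
  \<open>cosh x * cosh y + t * sinh x * sinh y\<close> increases in \<open>x\<close> and \<open>y\<close>.  At the radii it is the hyperbolic
  cosine of the side opposite to \<open>i\<close> when \<open>t\<close> is the inversive distance, so the law of cosines gives
  \<open>cos \<theta> > - t\<close>.
\<close>

lemma cosine_ratio_greater:
  assumes pos: "r$i > 0" "r$j > 0" "r$k > 0"
    and I: "I {i, j} \<ge> 0" "I {i, k} \<ge> 0" "I {j, k} \<ge> 0"
  shows "- I {j, k} < cosine_ratio (edge_length I r i j) (edge_length I r i k) (edge_length I r j k)"
proof -
  let ?a = "edge_length I r i j" and ?b = "edge_length I r i k"
  have a: "r$j < ?a" and b: "r$k < ?b" using radius_less_edge_length pos I by blast+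
  have "cosh (r$j) * cosh (r$k) < cosh ?a * cosh ?b"
    using a b pos by (intro mult_strict_mono) (auto simp: cosh_real_nonneg_less_iff cosh_real_pos)
  moreover have "sinh (r$j) * sinh (r$k) \<le> sinh ?a * sinh ?b"
    using a b pos by (intro mult_mono) auto
  then have "I {j, k} * (sinh (r$j) * sinh (r$k)) \<le> I {j, k} * (sinh ?a * sinh ?b)"
    using I by (intro mult_left_mono) auto
  moreover have "cosh (edge_length I r j k)
      = cosh (r$j) * cosh (r$k) + I {j, k} * (sinh (r$j) * sinh (r$k))"
    using cosh_edge_length[of r j k I] pos I by simp
  ultimately have "- I {j, k} * (sinh ?a * sinh ?b)
      < cosh ?a * cosh ?b - cosh (edge_length I r j k)" by simp
  moreover have "0 < sinh ?a * sinh ?b" using a b pos by simp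
  ultimately show ?thesis unfolding cosine_ratio_def by (simp add: pos_less_divide_eq)
qed

text \<open>
  For \<open>0 \<le> t < 1\<close> the number \<open>pi - Lam t\<close> is \<open>arccos (- t)\<close>; for larger \<open>t\<close> it is \<open>pi\<close>, which exceeds every
  angle of a nondegenerate triangle.
\<close>

lemma inner_angle_less_Lam:
  assumes sides: "hyp_sides a b c" and t: "0 \<le> t" "- t < cosine_ratio a b c"
  shows "inner_angle a b c < pi - Lam t"
proof (cases "t \<ge> 1")
  case True
  then show ?thesis using inner_angle_range(2)[OF sides] by (simp add: Lam_def)
next
  case False
  have "arccos (cosine_ratio a b c) < arccos (- t)"
    using False t cosine_ratio_bounds[OF sides] by (intro arccos_less_arccos) auto
  then show ?thesis
    using False t by (simp add: inner_angle_arccos[OF sides] Lam_def arccos_minus)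
qed

text \<open>
  The angles involve the inversive distance only on the sides of the faces, so these are the edges on
  which its sign is prescribed.
\<close>

locale circle_pattern =
  fixes F :: "'v::finite set set" and I :: "'v set \<Rightarrow> real" and r :: "real^'v"
  assumes face_card: "f \<in> F \<Longrightarrow> card f = 3"
    and nonneg: "f \<in> F \<Longrightarrow> e \<subseteq> f \<Longrightarrow> card e = 2 \<Longrightarrow> I e \<ge> 0"
    and radii: "r \<in> Omega I F"
begin

abbreviation "len i j \<equiv> edge_length I r i j"

lemma face_distinct: "{i, j, k} \<in> F \<Longrightarrow> i \<noteq> j \<and> i \<noteq> k \<and> j \<noteq> k"
  using face_card[of "{i, j, k}"] by (auto simp: card_insert_if split: if_splits)

lemma face_nonneg:
  assumes "{i, j, k} \<in> F"
  shows "I {i, j} \<ge> 0" "I {i, k} \<ge> 0" "I {j, k} \<ge> 0"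
  using assms face_distinct[OF assms] by (auto intro!: nonneg[OF assms])

lemma radius_pos: "r$i > 0"
  using radii by (simp add: Omega_def)

lemma face_sides:
  assumes "{i, j, k} \<in> F"
  shows "hyp_sides (len i j) (len i k) (len j k)"
proof -
  have pos: "0 < len x y" if "I {x, y} \<ge> 0" for x y
    using radius_less_edge_length[of r x y I] radius_pos that less_trans by blast
  have tri: "len x y < len x z + len y z" if "{x, y, z} = {i, j, k}" for x y z
    using radii assms that by (auto simp: Omega_def)
  have "len i j < len i k + len j k" by (rule tri) auto
  moreover have "len i k < len i j + len k j" by (rule tri) auto
  moreover have "len j k < len j i + len k i" by (rule tri) auto
  ultimately show ?thesis
    using pos face_nonneg[OF assms]
    unfolding hyp_sides_def edge_length_commute[of I r j i] edge_length_commute[of I r k i]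
      edge_length_commute[of I r k j]
    by auto
qed

lemma face_angle_inner_angle:
  assumes "{i, j, k} \<in> F"
  shows "face_angle I r i {i, j, k} = inner_angle (len i j) (len i k) (len j k)"
  unfolding face_angle_def
proof (rule the_equality)
  fix \<alpha>
  assume "\<exists>j' k'. {i, j, k} = {i, j', k'} \<and> \<alpha> = inner_angle (len i j') (len i k') (len j' k')"
  then obtain j' k' where eq: "{i, j, k} = {i, j', k'}"
    and \<alpha>: "\<alpha> = inner_angle (len i j') (len i k') (len j' k')" by blast
  have "j' \<noteq> k' \<and> i \<noteq> j' \<and> i \<noteq> k'" using face_distinct[of i j' k'] assms eq by metis
  then have "j' = j \<and> k' = k \<or> j' = k \<and> k' = j"
    using eq face_distinct[OF assms] by (auto simp: set_eq_iff) 
  then show "\<alpha> = inner_angle (len i j) (len i k) (len j k)"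
    using \<alpha> inner_angle_commute[OF face_sides[OF assms]] edge_length_commute by metis
qed blast

lemma face_angle_pos: "{i, j, k} \<in> F \<Longrightarrow> 0 < face_angle I r i {i, j, k}"
  by (simp add: face_angle_inner_angle inner_angle_range face_sides)

lemma face_angle_sum:
  assumes f: "f \<in> F"
  shows "(\<Sum>i\<in>f. face_angle I r i f) < pi"
proof -
  obtain i j k where f_eq: "f = {i, j, k}" using face_card[OF f] by (auto simp: card_3_iff)
  have perms: "f = {j, k, i}" "f = {k, i, j}" using f_eq by auto
  have F: "{i, j, k} \<in> F" "{j, k, i} \<in> F" "{k, i, j} \<in> F" using f f_eq perms by metis+
  have "face_angle I r i f = inner_angle (len i j) (len i k) (len j k)"
    using face_angle_inner_angle[OF F(1)] f_eq by simp
  moreover have "face_angle I r j f = inner_angle (len j k) (len i j) (len i k)"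
    using face_angle_inner_angle[OF F(2)] perms(1) edge_length_commute by metis
  moreover have "face_angle I r k f = inner_angle (len i k) (len j k) (len i j)"
    using face_angle_inner_angle[OF F(3)] perms(2) edge_length_commute by metis
  moreover have "(\<Sum>i\<in>f. face_angle I r i f)
      = face_angle I r i f + face_angle I r j f + face_angle I r k f"
    using face_distinct[OF F(1)] f_eq by simp
  ultimately show ?thesis
    using hyperbolic_angle_sum_less_pi[OF face_sides[OF F(1)]] by simp
qed

lemma face_angle_less_Lam:
  assumes f: "{i, j, k} \<in> F"
  shows "face_angle I r i {i, j, k} < pi - Lam (I {j, k})"
  unfolding face_angle_inner_angle[OF f]
  by (intro inner_angle_less_Lam face_sides[OF f] face_nonneg[OF f] cosine_ratio_greater radius_pos)

text \<open>
  The bound for the angles of one face at the vertices in \<open>A\<close>.  For a face with one vertex in \<open>A\<close> the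
  set \<open>f - A\<close> is the edge opposite to this vertex.
\<close>

definition angle_bound :: "'v set \<Rightarrow> 'v set \<Rightarrow> real" where
  "angle_bound A f =
     (if card (f \<inter> A) = 0 then 0 else if card (f \<inter> A) = 1 then pi - Lam (I (f - A)) else pi)"

lemma angles_less_bound:
  assumes f: "f \<in> F" and meets: "f \<inter> A \<noteq> {}"
  shows "(\<Sum>i\<in>f \<inter> A. face_angle I r i f) < angle_bound A f"
proof (cases "card (f \<inter> A) = 1")
  case True
  then obtain i where i: "f \<inter> A = {i}" by (auto simp: card_1_singleton_iff)
  have "card (f - {i}) = 2" using i face_card[OF f] by (subst card_Diff_singleton) auto
  then obtain j k where jk: "f - {i} = {j, k}" by (auto simp: card_2_iff)
  have "f = {i, j, k}" and "f - A = {j, k}" using i jk by auto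
  then show ?thesis
    using face_angle_less_Lam[of i j k] f i True by (simp add: angle_bound_def)
next
  case False
  have "0 \<le> face_angle I r i f" if "i \<in> f" for i
  proof -
    have "card (f - {i}) = 2" using that face_card[OF f] by (subst card_Diff_singleton) auto
    then obtain j k where "f - {i} = {j, k}" by (auto simp: card_2_iff)
    then have "f = {i, j, k}" using that by auto
    then show ?thesis using face_angle_pos[of i j k] f by simp
  qed
  then have "(\<Sum>i\<in>f \<inter> A. face_angle I r i f) \<le> (\<Sum>i\<in>f. face_angle I r i f)"
    by (intro sum_mono2) auto
  also have "\<dots> < pi" by (rule face_angle_sum[OF f])
  finally show ?thesis using False meets by (simp add: angle_bound_def)
qed

text \<open>
  Interchanging the sums over vertices and faces turns the curvature condition into an estimate face
  by face.
\<close>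

lemma zero_curvature_bound:
  assumes flat: "\<And>i. curvature I F r i = 0" and "A \<noteq> {}"
  shows "2 * pi * card A < (\<Sum>f\<in>F. angle_bound A f)"
proof -
  have around: "(\<Sum>f\<in>{f \<in> F. i \<in> f}. face_angle I r i f) = 2 * pi" for i
    using flat[of i] by (simp add: curvature_def)
  have "2 * pi * card A = (\<Sum>i\<in>A. \<Sum>f\<in>{f \<in> F. i \<in> f}. face_angle I r i f)"
    by (simp add: around)
  also have "\<dots> = (\<Sum>f\<in>F. \<Sum>i\<in>{i \<in> A. i \<in> f}. face_angle I r i f)"
    by (intro sum.swap_restrict) auto
  also have "\<dots> = (\<Sum>f\<in>F. \<Sum>i\<in>f \<inter> A. face_angle I r i f)"
    by (intro sum.cong) auto
  also have "\<dots> < (\<Sum>f\<in>F. angle_bound A f)"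
  proof (rule sum_strict_mono_ex1)
    show "\<forall>f\<in>F. (\<Sum>i\<in>f \<inter> A. face_angle I r i f) \<le> angle_bound A f"
    proof
      fix f assume "f \<in> F"
      then show "(\<Sum>i\<in>f \<inter> A. face_angle I r i f) \<le> angle_bound A f"
        using angles_less_bound[of f A] by (cases "f \<inter> A = {}") (auto simp: angle_bound_def)
    qed
    obtain i where i: "i \<in> A" using \<open>A \<noteq> {}\<close> by blast
    have "{f \<in> F. i \<in> f} \<noteq> {}"
    proof
      assume "{f \<in> F. i \<in> f} = {}"
      then have "(\<Sum>f\<in>{f \<in> F. i \<in> f}. face_angle I r i f) = 0" by (simp only: sum.empty)
      then show False using around[of i] by simp
    qed
    then show "\<exists>f\<in>F. (\<Sum>i\<in>f \<inter> A. face_angle I r i f) < angle_bound A f"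
      using i angles_less_bound by blast
  qed simp
  finally show ?thesis .
qed

text \<open>The link is another description of the faces with exactly one vertex in \<open>A\<close>.\<close>

lemma sum_Lk:
  assumes edges: "\<And>f e. f \<in> F \<Longrightarrow> e \<subseteq> f \<Longrightarrow> card e = 2 \<Longrightarrow> e \<in> E"
  shows "(\<Sum>(e, v)\<in>Lk E F A. g e) = (\<Sum>f\<in>{f \<in> F. card (f \<inter> A) = 1}. g (f - A))"
proof (rule sum.reindex_bij_witness[where j = "\<lambda>(e, v). insert v e"
      and i = "\<lambda>f. (f - A, the_elem (f \<inter> A))"])
  fix p assume "p \<in> Lk E F A"
  then obtain e v where p: "p = (e, v)" and e: "e \<inter> A = {}" "v \<in> A" "insert v e \<in> F"
    by (auto simp: Lk_def)
  have eq: "insert v e \<inter> A = {v}" "insert v e - A = e" using e by auto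
  show "(\<lambda>f. (f - A, the_elem (f \<inter> A))) (case p of (e, v) \<Rightarrow> insert v e) = p"
    "(case p of (e, v) \<Rightarrow> insert v e) \<in> {f \<in> F. card (f \<inter> A) = 1}"
    "g ((case p of (e, v) \<Rightarrow> insert v e) - A) = (case p of (e, v) \<Rightarrow> g e)"
    using e by (simp_all add: p eq)
next
  fix f assume "f \<in> {f \<in> F. card (f \<inter> A) = 1}"
  then obtain v where f: "f \<in> F" and v: "f \<inter> A = {v}" by (auto simp: card_1_singleton_iff)
  have "f - A = f - {v}" and ins: "insert v (f - A) = f" using v by auto
  then have "card (f - A) = 2" using v face_card[OF f] by (subst \<open>f - A = f - {v}\<close>, subst card_Diff_singleton) auto
  then have "f - A \<in> E" using edges[OF f] by auto
  then show "(case (f - A, the_elem (f \<inter> A)) of (e, v) \<Rightarrow> insert v e) = f"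
    "(f - A, the_elem (f \<inter> A)) \<in> Lk E F A"
    using f v ins by (auto simp: Lk_def)
qed

end

section \<open>At most two triangles at an edge\<close>

text \<open>
  The coordinates of a point of the realization are its barycentric coordinates.
\<close>

lemma axis_hull_iff:
  fixes s :: "'v::finite set"
  shows "x \<in> convex hull ((\<lambda>i. axis i 1) ` s) \<longleftrightarrow>
    (\<forall>i. 0 \<le> x $ i) \<and> (\<forall>i. i \<notin> s \<longrightarrow> x $ i = 0) \<and> (\<Sum>i\<in>UNIV. x $ i) = (1::real)"
    (is "?l \<longleftrightarrow> ?r")
proof
  let ?C = "{x :: real^'v. (\<forall>i. 0 \<le> x $ i) \<and> (\<forall>i. i \<notin> s \<longrightarrow> x $ i = 0) \<and> (\<Sum>i\<in>UNIV. x $ i) = 1}"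
  have "convex ?C"
    by (auto simp: convex_def sum.distrib simp flip: sum_distrib_left)
  moreover have "(\<lambda>i. axis i 1) ` s \<subseteq> ?C" by (auto simp: axis_def)
  ultimately have "convex hull ((\<lambda>i. axis i 1) ` s) \<subseteq> ?C" by (intro hull_minimal)
  then show "?l \<Longrightarrow> ?r" by blast
next
  assume r: ?r
  have "(\<Sum>i\<in>UNIV. x $ i *\<^sub>R axis i 1) = (\<Sum>i\<in>s. x $ i *\<^sub>R axis i (1::real))"
    using r by (intro sum.mono_neutral_right) auto
  moreover have "(\<Sum>i\<in>UNIV. x $ i *\<^sub>R axis i (1::real)) = x"
    by (simp add: vec_eq_iff axis_def if_distrib[of "\<lambda>t. x $ _ * t"] cong: if_cong)
  moreover have "(\<Sum>i\<in>s. x $ i) = (\<Sum>i\<in>UNIV. x $ i)"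
    using r by (intro sum.mono_neutral_left) auto
  then have "(\<Sum>i\<in>s. x $ i *\<^sub>R axis i (1::real)) \<in> convex hull ((\<lambda>i. axis i 1) ` s)"
    using r by (intro convex_sum) (auto intro: hull_inc)
  ultimately show ?l by simp
qed

text \<open>
  A chart of the union of the triangles \<open>{i, j, k}\<close> and \<open>{i, j, l}\<close> near the midpoint of their common
  edge: the first coordinate runs along the edge, and the sign of the second selects the triangle.
\<close>

definition two_triangle_chart :: "'v \<Rightarrow> 'v \<Rightarrow> 'v \<Rightarrow> 'v \<Rightarrow> real^2 \<Rightarrow> real^'v::finite" where
  "two_triangle_chart i j k l x =
     (1/2 + x$1 - \<bar>x$2\<bar>/2) *\<^sub>R axis i 1 + (1/2 - x$1 - \<bar>x$2\<bar>/2) *\<^sub>R axis j 1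
       + max (x$2) 0 *\<^sub>R axis k 1 + max (- x$2) 0 *\<^sub>R axis l 1"

lemma continuous_two_triangle_chart: "continuous_on S (two_triangle_chart i j k l)"
  unfolding two_triangle_chart_def by (intro continuous_intros) auto

lemma two_triangle_chart_coords:
  assumes "i \<noteq> j" "i \<noteq> k" "i \<noteq> l" "j \<noteq> k" "j \<noteq> l" "k \<noteq> l"
  shows "two_triangle_chart i j k l x $ i = 1/2 + x$1 - \<bar>x$2\<bar>/2"
    and "two_triangle_chart i j k l x $ j = 1/2 - x$1 - \<bar>x$2\<bar>/2"
    and "two_triangle_chart i j k l x $ k = max (x$2) 0"
    and "two_triangle_chart i j k l x $ l = max (- x$2) 0"
    and "m \<notin> {i, j, k, l} \<Longrightarrow> two_triangle_chart i j k l x $ m = 0"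
  using assms by (auto simp: two_triangle_chart_def axis_def)

lemma inj_two_triangle_chart:
  assumes "i \<noteq> j" "i \<noteq> k" "i \<noteq> l" "j \<noteq> k" "j \<noteq> l" "k \<noteq> l"
  shows "inj (two_triangle_chart i j k l)"
proof (rule injI)
  fix x y :: "real^2"
  assume eq: "two_triangle_chart i j k l x = two_triangle_chart i j k l y"
  note c = two_triangle_chart_coords(1-4)[OF assms]
  have "max (x$2) 0 = max (y$2) 0" "max (- x$2) 0 = max (- y$2) 0"
    "1/2 + x$1 - \<bar>x$2\<bar>/2 = 1/2 + y$1 - \<bar>y$2\<bar>/2"
    using c[of x] c[of y] eq by simp_all
  then have "x$1 = y$1 \<and> x$2 = y$2" by (auto simp: max_def split: if_splits)
  then show "x = y" by (simp add: vec_eq_iff forall_2)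
qed

lemma two_triangle_chart_in_realization:
  assumes dist: "i \<noteq> j" "i \<noteq> k" "i \<noteq> l" "j \<noteq> k" "j \<noteq> l" "k \<noteq> l"
    and F: "{i, j, k} \<in> F" "{i, j, l} \<in> F" and x: "\<bar>x$1\<bar> \<le> 1/4" "\<bar>x$2\<bar> \<le> 1/2"
  shows "two_triangle_chart i j k l x \<in> realization E F"
proof -
  let ?y = "two_triangle_chart i j k l x"
  note c = two_triangle_chart_coords[OF dist]
  have nonneg: "0 \<le> ?y $ m" for m
    using c(1-4)[of x] c(5)[of m x] x by (cases "m \<in> {i, j, k, l}") auto
  have "(\<Sum>m\<in>UNIV. ?y $ m) = (\<Sum>m\<in>{i, j, k, l}. ?y $ m)"
    using c(5) by (intro sum.mono_neutral_right) auto
  also have "\<dots> = 1" using dist by (simp add: c max_def)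
  finally have sum: "(\<Sum>m\<in>UNIV. ?y $ m) = 1" .
  let ?s = "if x$2 \<ge> 0 then {i, j, k} else {i, j, l}"
  have "?y $ n = 0" if "n \<notin> ?s" for n
    using that c(3-4)[of x] c(5)[of n x]
    by (cases "n \<in> {i, j, k, l}") (auto split: if_splits)
  then have "?y \<in> convex hull ((\<lambda>i. axis i 1) ` ?s)"
    unfolding axis_hull_iff using nonneg sum by blast
  moreover have "?s \<in> simplices E F" using F by (simp add: simplices_def)
  ultimately show ?thesis unfolding realization_def by blast
qed

lemma chart_at_point_of_surface:
  assumes "closed_surface M" and "M homeomorphic_space top_of_set X" and "p \<in> X"
  obtains U and W :: "(real^2) set" and \<phi> \<psi> where "openin (top_of_set X) U" "p \<in> U" "open W"
    "homeomorphism U W \<phi> \<psi>"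
proof -
  obtain f g where fg: "homeomorphic_maps M (top_of_set X) f g"
    using assms(2) by (auto simp: homeomorphic_space_def)
  have f: "homeomorphic_map M (top_of_set X) f"
    using fg homeomorphic_maps_map by blast
  have gp: "g p \<in> topspace M" and fgp: "f (g p) = p"
    using fg assms(3) by (auto simp: homeomorphic_maps_def continuous_map_def)
  obtain U and W :: "(real^2) set" where U: "openin M U" "g p \<in> U" "open W"
    "subtopology M U homeomorphic_space top_of_set W"
    using assms(1) gp unfolding closed_surface_def by blast
  have sub: "U \<subseteq> topspace M" using U(1) openin_subset by blast
  have im: "f ` U \<subseteq> X" using homeomorphic_imp_surjective_map[OF f] sub by auto
  have "homeomorphic_map (subtopology M U) (subtopology (top_of_set X) (f ` U)) f"
    using f sub by (intro homeomorphic_map_subtopologies) (auto simp: homeomorphic_eq_everything_map)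
  then have "subtopology M U homeomorphic_space top_of_set (f ` U)"
    using homeomorphic_map_imp_homeomorphic_space im by (fastforce simp: subtopology_subtopology Int_absorb1)
  then have "top_of_set (f ` U) homeomorphic_space top_of_set W"
    using U(4) homeomorphic_space_sym homeomorphic_space_trans by blast
  then obtain \<phi> \<psi> where maps: "homeomorphic_maps (top_of_set (f ` U)) (top_of_set W) \<phi> \<psi>"
    unfolding homeomorphic_space_def by blast
  have "homeomorphism (f ` U) W \<phi> \<psi>"
  proof (rule homeomorphismI)
    show "continuous_on (f ` U) \<phi>" "continuous_on W \<psi>" "\<phi> ` f ` U \<subseteq> W" "\<psi> ` W \<subseteq> f ` U"
      using maps by (auto simp: homeomorphic_maps_def)
  qed (use maps in \<open>auto simp: homeomorphic_maps_def\<close>)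
  moreover have "openin (top_of_set X) (f ` U)"
    using f U(1) homeomorphic_map_openness_eq by blast
  moreover have "p \<in> f ` U" using U(2) fgp by force
  ultimately show thesis using that U(3) by blast
qed

text \<open>
  A third triangle \<open>{i, j, m}\<close> on the edge \<open>{i, j}\<close> has points arbitrarily near to the midpoint that
  the chart of the other two triangles misses.  But invariance of domain, applied to that chart
  followed by one of the surface, makes the image of the former a neighbourhood of the midpoint.
\<close>

lemma no_three_triangles_at_edge:
  fixes F :: "'v::finite set set"
  assumes surf: "closed_surface M" "M homeomorphic_space top_of_set (realization E F)"
    and dist: "i \<noteq> j" "i \<noteq> k" "i \<noteq> l" "j \<noteq> k" "j \<noteq> l" "k \<noteq> l"
    and m: "m \<notin> {i, j, k, l}"
    and F: "{i, j, k} \<in> F" "{i, j, l} \<in> F" "{i, j, m} \<in> F"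
  shows False
proof -
  let ?X = "realization E F" and ?c = "two_triangle_chart i j k l"
  define p where "p = ?c 0"
  define B where "B = {x :: real^2. \<bar>x$1\<bar> < 1/4 \<and> \<bar>x$2\<bar> < 1/2}"
  have "open B"
    unfolding B_def by (intro open_Collect_conj open_Collect_less continuous_intros)
  have cB: "?c ` B \<subseteq> ?X"
    using two_triangle_chart_in_realization[OF dist F(1,2)] by (force simp: B_def)
  have "0 \<in> B" by (simp add: B_def)
  then have "p \<in> ?X" using cB by (auto simp: p_def)
  obtain U and W :: "(real^2) set" and \<phi> \<psi> where U: "openin (top_of_set ?X) U" "p \<in> U"
    and W: "open W" and hom: "homeomorphism U W \<phi> \<psi>"
    using chart_at_point_of_surface[OF surf \<open>p \<in> ?X\<close>] by metis
  obtain V where V: "open V" "U = ?X \<inter> V" using U(1) by (auto simp: openin_open)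
  define D where "D = B \<inter> ?c -` V"
  have "open D"
    unfolding D_def using \<open>open B\<close> V(1) continuous_two_triangle_chart
    by (intro open_Int open_vimage) auto
  have cD: "?c ` D \<subseteq> U" using cB V(2) by (auto simp: D_def)
  have "0 \<in> D" using \<open>0 \<in> B\<close> U(2) V(2) by (auto simp: D_def p_def)
  have "open ((\<phi> \<circ> ?c) ` D)"
  proof (rule invariance_of_domain)
    show "continuous_on D (\<phi> \<circ> ?c)"
      using hom cD continuous_two_triangle_chart
      by (intro continuous_on_compose) (auto simp: homeomorphism_def intro: continuous_on_subset)
    have "inj_on \<phi> U" using hom by (metis homeomorphism_def inj_on_inverseI)
    then show "inj_on (\<phi> \<circ> ?c) D"
      using inj_two_triangle_chart[OF dist] cD by (intro comp_inj_on) (auto intro: inj_on_subset)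
  qed (rule \<open>open D\<close>)
  moreover have "\<phi> ` ?c ` D \<subseteq> W" using cD hom by (auto simp: homeomorphism_def)
  ultimately have "openin (top_of_set W) (\<phi> ` ?c ` D)"
    by (simp add: openin_open_eq[OF W] image_comp)
  then have "openin (top_of_set U) (\<psi> ` \<phi> ` ?c ` D)"
    using hom homeomorphism_imp_open_map homeomorphism_symD by blast
  moreover have "\<psi> ` \<phi> ` ?c ` D = ?c ` D"
    using cD hom by (force simp: homeomorphism_def image_image)
  ultimately have "openin (top_of_set ?X) (?c ` D)"
    using U(1) openin_trans by metis
  then obtain G where G: "open G" "?c ` D = ?X \<inter> G" by (auto simp: openin_open)
  have "p \<in> G" using \<open>0 \<in> D\<close> G(2) by (auto simp: p_def)

  \<comment> \<open>The median from the midpoint of the edge into the third triangle.\<close>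
  define q :: "real \<Rightarrow> real^'v" where
    "q t = ((1 - t)/2) *\<^sub>R axis i 1 + ((1 - t)/2) *\<^sub>R axis j 1 + t *\<^sub>R axis m 1" for t
  have "open (q -` G)"
    unfolding q_def by (intro open_vimage G(1) continuous_intros) auto
  moreover have "q 0 = p" by (simp add: p_def q_def two_triangle_chart_def)
  then have "0 \<in> q -` G" using \<open>p \<in> G\<close> by simp
  ultimately obtain \<epsilon> where \<epsilon>: "\<epsilon> > 0" "ball 0 \<epsilon> \<subseteq> q -` G"
    unfolding open_contains_ball by blast
  define t where "t = min (\<epsilon>/2) (1/2)"
  have t: "0 < t" "t < 1" "q t \<in> G" using \<epsilon> by (auto simp: t_def subset_eq)
  have co: "q t $ i = (1 - t)/2" "q t $ j = (1 - t)/2" "q t $ m = t"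
    "\<And>n. n \<notin> {i, j, m} \<Longrightarrow> q t $ n = 0"
    using dist m by (auto simp: q_def axis_def)
  have nonneg: "0 \<le> q t $ n" for n
    using co t by (cases "n \<in> {i, j, m}") auto
  have "(\<Sum>n\<in>UNIV. q t $ n) = (\<Sum>n\<in>{i, j, m}. q t $ n)"
    using co(4) by (intro sum.mono_neutral_right) auto
  moreover have "(\<Sum>n\<in>{i, j, m}. q t $ n) = q t $ i + (q t $ j + q t $ m)"
    using dist m by (subst sum.insert; force)+
  ultimately have "(\<Sum>n\<in>UNIV. q t $ n) = 1" by (simp add: co field_simps)
  then have "q t \<in> convex hull ((\<lambda>i. axis i 1) ` {i, j, m})"
    unfolding axis_hull_iff using nonneg co(4) by blast
  then have "q t \<in> ?X" using F(3) unfolding realization_def simplices_def by blast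
  then have "q t \<in> ?c ` D" using G(2) t by blast
  then obtain x where "q t = ?c x" by blast
  then have "q t $ m = 0" using two_triangle_chart_coords(5)[OF dist m] by simp
  then show False using co(3) t by simp
qed

lemma edge_in_at_most_two_faces:
  assumes surf: "closed_surface M" and tri: "triangulates M E F" and e: "card e = 2"
  shows "card {f \<in> F. e \<subseteq> f} \<le> 2"
proof (rule ccontr)
  assume "\<not> ?thesis"
  then obtain T where T: "T \<subseteq> {f \<in> F. e \<subseteq> f}" "card T = 3"
    using obtain_subset_with_card_n[of 3 "{f \<in> F. e \<subseteq> f}"] by (auto simp: not_le)
  then obtain f g h where fgh: "T = {f, g, h}" "f \<noteq> g" "f \<noteq> h" "g \<noteq> h"
    by (auto simp: card_3_iff)
  obtain i j where ij: "e = {i, j}" "i \<noteq> j" using e by (auto simp: card_2_iff)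
  have third: "\<exists>k. k \<notin> {i, j} \<and> s = {i, j, k}" if "s \<in> T" for s
  proof -
    have s: "card s = 3" "e \<subseteq> s" using that T tri by (auto simp: triangulates_def)
    then have "card (s - e) = 1" using e by (simp add: card_Diff_subset)
    then obtain k where "s - e = {k}" by (auto simp: card_1_singleton_iff)
    then show ?thesis using s ij by (intro exI[of _ k]) auto
  qed
  obtain k where k: "k \<notin> {i, j}" "f = {i, j, k}" using third fgh by blast
  obtain l where l: "l \<notin> {i, j}" "g = {i, j, l}" using third fgh by blast
  obtain m where m: "m \<notin> {i, j}" "h = {i, j, m}" using third fgh by blast
  have "k \<noteq> l" "k \<noteq> m" "l \<noteq> m" using k l m fgh by auto
  then show False
    using no_three_triangles_at_edge[of M E F i j k l m] surf tri ij k l m T(1) fgh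
    by (auto simp: triangulates_def)
qed

section \<open>Counting faces by their vertices in a set\<close>

lemma euler_characteristic_full_subcomplex:
  fixes E F :: "'v::finite set set"
  assumes "\<forall>e\<in>E. card e = 2" "\<forall>f\<in>F. card f = 3"
  shows "euler_characteristic (full_subcomplex E F A)
    = int (card A) - int (card {e \<in> E. e \<subseteq> A}) + int (card {f \<in> F. f \<subseteq> A})"
proof -
  let ?V = "(\<lambda>i. {i}) ` A" and ?E = "{e \<in> E. e \<subseteq> A}" and ?F = "{f \<in> F. f \<subseteq> A}"
  let ?w = "\<lambda>s :: 'v set. (-1) ^ (card s - 1) :: int"
  have "full_subcomplex E F A = ?V \<union> ?E \<union> ?F"
    by (auto simp: full_subcomplex_def simplices_def)
  moreover have "?V \<inter> ?E = {}" "(?V \<union> ?E) \<inter> ?F = {}" using assms by fastforce+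
  ultimately have "euler_characteristic (full_subcomplex E F A) = sum ?w ?V + sum ?w ?E + sum ?w ?F"
    unfolding euler_characteristic_def by (simp add: sum.union_disjoint)
  moreover have "sum ?w ?V = card A" by (simp add: sum.reindex)
  moreover have "sum ?w ?E = (\<Sum>e\<in>?E. -1)" using assms by (intro sum.cong) auto
  moreover have "sum ?w ?F = (\<Sum>f\<in>?F. 1)" using assms by (intro sum.cong) auto
  ultimately show ?thesis by simp
qed

text \<open>
  A face with \<open>n\<close> vertices in \<open>A\<close> has \<open>n choose 2\<close> edges within \<open>A\<close>, and each of these edges is counted
  at most twice.  Since \<open>n choose 2\<close> is \<open>1\<close> for \<open>n = 2\<close> and \<open>3\<close> for \<open>n = 3\<close>, subtracting \<open>2\<close> for each
  face within \<open>A\<close> leaves the number of faces with at least two vertices in \<open>A\<close>.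
\<close>

lemma euler_characteristic_double_count:
  fixes E F :: "'v::finite set set"
  assumes E: "\<forall>e\<in>E. card e = 2" and F: "\<forall>f\<in>F. card f = 3"
    and edges: "\<forall>f\<in>F. \<forall>e. e \<subseteq> f \<and> card e = 2 \<longrightarrow> e \<in> E"
    and two: "\<And>e. e \<in> E \<Longrightarrow> card {f \<in> F. e \<subseteq> f} \<le> 2"
  shows "2 * euler_characteristic (full_subcomplex E F A)
    \<le> 2 * int (card A) - int (card {f \<in> F. card (f \<inter> A) \<ge> 2})"
proof -
  let ?E = "{e \<in> E. e \<subseteq> A}" and ?F = "{f \<in> F. f \<subseteq> A}"
  have inside: "f \<subseteq> A \<longleftrightarrow> card (f \<inter> A) = 3" if "f \<in> F" for f
    using F that by (metis Int_absorb2 Int_lower1 card_subset_eq finite inf.orderI)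
  have "(\<Sum>f\<in>F. card {e \<in> ?E. e \<subseteq> f}) = (\<Sum>e\<in>?E. card {f \<in> F. e \<subseteq> f})"
    using sum.swap_restrict[of F ?E "\<lambda>_ _. 1::nat" "\<lambda>f e. e \<subseteq> f"] by simp
  also have "\<dots> \<le> (\<Sum>e\<in>?E. 2)" using two by (intro sum_mono) auto
  also have "\<dots> = 2 * card ?E" by simp
  finally have "(\<Sum>f\<in>F. card {e \<in> ?E. e \<subseteq> f}) \<le> 2 * card ?E" .
  moreover have "card {e \<in> ?E. e \<subseteq> f} = of_bool (card (f \<inter> A) \<ge> 2) + 2 * of_bool (f \<subseteq> A)"
    if f: "f \<in> F" for f
  proof -
    have "{e \<in> ?E. e \<subseteq> f} = {e. e \<subseteq> f \<inter> A \<and> card e = 2}" using E edges f by auto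
    then have "card {e \<in> ?E. e \<subseteq> f} = card (f \<inter> A) choose 2"
      by (simp only: n_subsets[OF finite])
    moreover have "card (f \<inter> A) \<le> 3" using F f card_mono[of f "f \<inter> A"] by simp
    then consider "card (f \<inter> A) = 0" | "card (f \<inter> A) = 1" | "card (f \<inter> A) = 2" | "card (f \<inter> A) = 3"
      by linarith
    then have "card (f \<inter> A) choose 2
        = of_bool (card (f \<inter> A) \<ge> 2) + 2 * of_bool (card (f \<inter> A) = 3)"
      by cases (simp_all only:, simp_all add: choose_two)
    ultimately show ?thesis by (simp only: inside[OF f])
  qed
  moreover have "(\<Sum>f\<in>F. of_bool (card (f \<inter> A) \<ge> 2) + 2 * of_bool (f \<subseteq> A))
      = card {f \<in> F. card (f \<inter> A) \<ge> 2} + 2 * card ?F"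
    by (simp add: sum.distrib Int_def flip: sum_distrib_left)
  ultimately have "card {f \<in> F. card (f \<inter> A) \<ge> 2} + 2 * card ?F \<le> 2 * card ?E" by simp
  then show ?thesis
    unfolding euler_characteristic_full_subcomplex[OF E F] by simp
qed

section \<open>The obstruction to zero curvature\<close>

theorem corollary4p4:
  fixes M :: "'a topology" and E F :: "'v::finite set set" and I :: "'v set \<Rightarrow> real"
    and A :: "'v set"
  assumes "closed_surface M"
    and "triangulates M E F"
    and "\<forall>e\<in>E. I e \<ge> 0"
    and "\<exists>r\<in>Omega I F. \<forall>i. curvature I F r i = 0"
    and "A \<noteq> {}" and "A \<noteq> UNIV"
  shows "(\<Sum>(e, v)\<in>Lk E F A. pi - Lam (I e))
           > 2 * pi * real_of_int (euler_characteristic (full_subcomplex E F A))"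
proof -
  have E: "\<forall>e\<in>E. card e = 2" and F: "\<forall>f\<in>F. card f = 3"
    and edges: "\<forall>f\<in>F. \<forall>e. e \<subseteq> f \<and> card e = 2 \<longrightarrow> e \<in> E"
    using assms(2) by (auto simp: triangulates_def)
  obtain r where r: "r \<in> Omega I F" "\<And>i. curvature I F r i = 0" using assms(4) by blast
  interpret circle_pattern F I r
    by unfold_locales (use F edges assms(3) r(1) in auto)
  let ?F1 = "{f \<in> F. card (f \<inter> A) = 1}" and ?F2 = "{f \<in> F. card (f \<inter> A) \<ge> 2}"
  have "(\<Sum>f\<in>F. angle_bound A f) = (\<Sum>f\<in>?F1 \<union> ?F2. angle_bound A f)"
  proof (intro sum.mono_neutral_right ballI)
    fix f assume "f \<in> F - (?F1 \<union> ?F2)"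
    then have "card (f \<inter> A) \<noteq> 1" "\<not> card (f \<inter> A) \<ge> 2" by blast+
    then have "card (f \<inter> A) = 0" by linarith
    then show "angle_bound A f = 0" unfolding angle_bound_def by (rule if_P)
  qed auto
  also have "\<dots> = (\<Sum>f\<in>?F1. angle_bound A f) + (\<Sum>f\<in>?F2. angle_bound A f)"
    by (intro sum.union_disjoint) auto
  also have "(\<Sum>f\<in>?F1. angle_bound A f) = (\<Sum>f\<in>?F1. pi - Lam (I (f - A)))"
    by (intro sum.cong) (auto simp: angle_bound_def)
  also have "\<dots> = (\<Sum>(e, v)\<in>Lk E F A. pi - Lam (I e))"
    using edges by (intro sum_Lk[symmetric]) auto
  also have "(\<Sum>f\<in>?F2. angle_bound A f) = (\<Sum>f\<in>?F2. pi)"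
    by (intro sum.cong) (auto simp: angle_bound_def)
  finally have "2 * pi * card A < (\<Sum>(e, v)\<in>Lk E F A. pi - Lam (I e)) + pi * card ?F2"
    using zero_curvature_bound[OF r(2) assms(5)] by (simp add: mult.commute)
  moreover have "2 * euler_characteristic (full_subcomplex E F A)
      \<le> 2 * int (card A) - int (card ?F2)"
    using edge_in_at_most_two_faces[OF assms(1,2)] E F edges
    by (intro euler_characteristic_double_count) auto
  then have "pi * real_of_int (2 * euler_characteristic (full_subcomplex E F A))
      \<le> pi * real_of_int (2 * int (card A) - int (card ?F2))"
    by (intro mult_left_mono) (auto simp del: of_int_mult of_int_diff)
  ultimately show ?thesis by (simp add: algebra_simps)
qed

end
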